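(* Let $d\ge 1$ and let $p\in\mathbb{C}[z_1,\ldots,z_d]$ be a polynomial with $p(0)=1$. Then there exist $n=(n_1,\ldots,n_d)\in\mathbb{N}_0^d$ and a matrix $K\in\mathbb{C}^{|n|\times|n|}$ such that $$p(z)=\det(I_{|n|}-KZ_n).$$
   Context: $\mathbb{N}_0$ is the set of nonnegative integers. For $n=(n_1,\ldots,n_d)\in\mathbb{N}_0^d$, $|n|=n_1+\cdots+n_d$ and $Z_n=\bigoplus_{i=1}^d z_iI_{n_i}$ is the $|n|\times|n|$ diagonal matrix whose diagonal consists of $z_1$ repeated $n_1$ times, then $z_2$ repeated $n_2$ times, ..., then $z_d$ repeated $n_d$ times. The determinant of an empty matrix is $1$. *)

theory Defs
  imports "HOL-Library.Poly_Mapping" "Jordan_Normal_Form.Determinant"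
begin

text \<open>
  A polynomial is a finitely supported family of coefficients indexed by
  exponents \<^typ>\<open>nat \<Rightarrow>\<^sub>0 nat\<close>, where the variable $z_{i+1}$ has index \<open>i\<close>.
\<close>

type_synonym cpoly = "(nat \<Rightarrow>\<^sub>0 nat) \<Rightarrow>\<^sub>0 complex"

definition polys_in :: "nat \<Rightarrow> cpoly set" where
  "polys_in d = {p. \<forall>m \<in> Poly_Mapping.keys p. Poly_Mapping.keys m \<subseteq> {..<d}}"

text \<open>
  Evaluation at a point \<open>z\<close> is meaningful only for polynomials in the first
  \<^term>\<open>dim_vec z\<close> variables.
\<close>

definition eval_cpoly :: "cpoly \<Rightarrow> complex vec \<Rightarrow> complex" where
  "eval_cpoly p z =
     (\<Sum>m \<in> Poly_Mapping.keys p. Poly_Mapping.lookup p m *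
        (\<Prod>i<dim_vec z. (z $ i) ^ Poly_Mapping.lookup m i))"

definition multi_size :: "nat vec \<Rightarrow> nat" where
  "multi_size n = (\<Sum>i<dim_vec n. n $ i)"

definition Z_mat :: "nat vec \<Rightarrow> complex vec \<Rightarrow> complex mat" where
  "Z_mat n z = diag_block_mat (map (\<lambda>i. (z $ i) \<cdot>\<^sub>m 1\<^sub>m (n $ i)) [0..<dim_vec n])"

lemma Z_mat_carrier: "Z_mat n z \<in> carrier_mat (multi_size n) (multi_size n)"
  by (auto simp: Z_mat_def multi_size_def dim_diag_block_mat comp_def
      interv_sum_list_conv_sum_set_nat lessThan_atLeast0)

end

theory Submission
  imports Defs
begin

text \<open>
  List the nonzero monomials dividing a monomial of \<open>p\<close>, ordered by their largest variable and
  then by the exponent of that variable. Dividing a monomial by its largest variable yields \<open>1\<close> or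
  an earlier monomial. Hence the vector \<open>x\<close> of these quotients satisfies \<open>(I - M Z) x = b\<close>, where
  \<open>M\<close> is a strictly lower triangular 0-1 matrix, \<open>Z\<close> is diagonal with the largest variables of the
  monomials as entries and \<open>b\<close> is a constant vector, while \<open>Z x\<close> is the vector of the monomials
  themselves. If \<open>c\<close> is the row of their coefficients in \<open>p\<close>, the matrix determinant lemma
  gives \<open>det (I - (M - b c) Z) = det (I - M Z) (1 + c Z x) = p\<close>.
\<close>

section \<open>Determinants and block diagonal matrices\<close>

text \<open>Both sides equal the determinant of the bordered matrix \<open>F\<close> with blocks
  \<open>A\<close>, \<open>A * x\<close>, \<open>w\<close>, \<open>1\<close>: column operations
  clear its upper right block and give the right side, row operations give the left side. Writing
  the rank-one column as \<open>A * x\<close> avoids an inverse of \<open>A\<close>.\<close>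

lemma det_minus_rank_one:
  fixes A :: "'a :: idom mat"
  assumes A: "A \<in> carrier_mat n n" and x: "x \<in> carrier_mat n 1" and w: "w \<in> carrier_mat 1 n"
  shows "det (A - (A * x) * w) = det A * (1 - (w * x) $$ (0, 0))"
proof -
  have b: "A * x \<in> carrier_mat n 1"
    using A x by simp
  have bw: "A * x * w \<in> carrier_mat n n"
    using b w by (rule mult_carrier_mat)
  have Abw: "A - A * x * w \<in> carrier_mat n n"
    using bw by (rule minus_carrier_mat)
  define F where "F = four_block_mat A (A * x) w (1\<^sub>m 1)"
  have F: "F \<in> carrier_mat (n + 1) (n + 1)"
    unfolding F_def using A by (intro four_block_carrier_mat) auto
  have P: "four_block_mat (1\<^sub>m n) (- x) (0\<^sub>m 1 n) (1\<^sub>m 1) \<in> carrier_mat (n + 1) (n + 1)"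
    by (intro four_block_carrier_mat) auto
  have "A * (- x) + A * x * 1\<^sub>m 1 = 0\<^sub>m n 1"
    using A x b by (intro eq_matI) auto
  moreover have "w * (- x) + 1\<^sub>m 1 * 1\<^sub>m 1 = 1\<^sub>m 1 - w * x"
    using w x by (intro eq_matI) auto
  ultimately have "F * four_block_mat (1\<^sub>m n) (- x) (0\<^sub>m 1 n) (1\<^sub>m 1)
      = four_block_mat A (0\<^sub>m n 1) w (1\<^sub>m 1 - w * x)"
    unfolding F_def using A b w x
    by (subst mult_four_block_mat[of _ n n _ 1 _ 1 _ _ n _ 1]) (auto simp: left_mult_zero_mat)
  moreover have "det (four_block_mat (1\<^sub>m n) (- x) (0\<^sub>m 1 n) (1\<^sub>m 1)) = 1"
    using x by (subst det_four_block_mat_lower_left_zero[of _ n _ 1]) auto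
  moreover have "det (four_block_mat A (0\<^sub>m n 1) w (1\<^sub>m 1 - w * x)) = det A * det (1\<^sub>m 1 - w * x)"
    using A w x by (intro det_four_block_mat_upper_right_zero) auto
  moreover have "det (1\<^sub>m 1 - w * x) = 1 - (w * x) $$ (0, 0)"
    using w x by (subst det_single) auto
  ultimately have right: "det F = det A * (1 - (w * x) $$ (0, 0))"
    using det_mult[OF F P] by simp
  \<comment> \<open>Row operations: \<open>F\<close> factors through a unipotent upper block matrix,
    which leaves the Schur complement of the corner \<open>1\<close>.\<close>
  have Q: "four_block_mat (1\<^sub>m n) (A * x) (0\<^sub>m 1 n) (1\<^sub>m 1) \<in> carrier_mat (n + 1) (n + 1)"
    by (intro four_block_carrier_mat) auto
  have R: "four_block_mat (A - A * x * w) (0\<^sub>m n 1) w (1\<^sub>m 1) \<in> carrier_mat (n + 1) (n + 1)"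
    by (intro four_block_carrier_mat Abw one_carrier_mat)
  have "1\<^sub>m n * (A - A * x * w) + A * x * w = A"
    unfolding left_mult_one_mat[OF Abw] using A bw by (intro eq_matI) auto
  then have "four_block_mat (1\<^sub>m n) (A * x) (0\<^sub>m 1 n) (1\<^sub>m 1)
      * four_block_mat (A - A * x * w) (0\<^sub>m n 1) w (1\<^sub>m 1) = F"
    unfolding F_def
    using right_mult_one_mat[OF b] left_add_zero_mat[OF b]
      mult_four_block_mat[OF one_carrier_mat b zero_carrier_mat one_carrier_mat
        Abw zero_carrier_mat w one_carrier_mat] w
    by (simp add: left_mult_zero_mat[OF Abw])
  moreover have "det (four_block_mat (1\<^sub>m n) (A * x) (0\<^sub>m 1 n) (1\<^sub>m 1)) = 1"
    using b by (subst det_four_block_mat_lower_left_zero[of _ n _ 1]) auto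
  moreover have "det (four_block_mat (A - A * x * w) (0\<^sub>m n 1) w (1\<^sub>m 1)) = det (A - A * x * w)"
    using det_four_block_mat_upper_right_zero[OF Abw refl w one_carrier_mat] by simp
  ultimately have "det F = det (A - A * x * w)"
    using det_mult[OF Q R] by simp
  with right show ?thesis
    by simp
qed

lemma four_block_mat_diag:
  "four_block_mat (mat_diag (length xs) ((!) xs)) (0\<^sub>m (length xs) (length ys))
     (0\<^sub>m (length ys) (length xs)) (mat_diag (length ys) ((!) ys)) =
   mat_diag (length (xs @ ys)) ((!) (xs @ ys))"
  by (intro eq_matI) (auto simp: mat_diag_def nth_append)

text \<open>Flattens a block matrix such as \<open>Z_mat n z\<close> to the list of its diagonal
  entries, which can then be matched with a list of monomials.\<close>

lemma diag_block_mat_smult_one: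
  "diag_block_mat (map (\<lambda>i. f i \<cdot>\<^sub>m 1\<^sub>m (k i)) is) =
     (let ds = concat (map (\<lambda>i. replicate (k i) (f i :: 'a :: semiring_1)) is)
      in mat_diag (length ds) ((!) ds))"
proof (induction "is")
  case Nil
  show ?case by (auto simp: mat_diag_def)
next
  case (Cons i "is")
  define ds where "ds = concat (map (\<lambda>i. replicate (k i) (f i)) is)"
  have "f i \<cdot>\<^sub>m 1\<^sub>m (k i) =
      mat_diag (length (replicate (k i) (f i))) ((!) (replicate (k i) (f i)))"
    by (intro eq_matI) (auto simp: mat_diag_def)
  moreover have "diag_block_mat (map (\<lambda>i. f i \<cdot>\<^sub>m 1\<^sub>m (k i)) is) = mat_diag (length ds) ((!) ds)"
    using Cons.IH by (simp add: ds_def Let_def)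
  ultimately show ?case
    using four_block_mat_diag[of "replicate (k i) (f i)" ds]
    by (simp add: Let_def ds_def [symmetric] mat_diag_def)
qed

section \<open>Lists concatenated from blocks, and sums over distinct lists\<close>

lemma sorted_wrt_concat_map_upt:
  assumes "\<And>i. i < d \<Longrightarrow> sorted_wrt P (f i)"
    and "\<And>i j a b. i < j \<Longrightarrow> j < d \<Longrightarrow> a \<in> set (f i) \<Longrightarrow> b \<in> set (f j) \<Longrightarrow> P a b"
  shows "sorted_wrt P (concat (map f [0..<d]))"
  using assms by (induction d) (auto simp: sorted_wrt_append)

lemma distinct_concat_map_upt:
  assumes "\<And>i. i < d \<Longrightarrow> distinct (f i)"
    and "\<And>i j. i < j \<Longrightarrow> j < d \<Longrightarrow> set (f i) \<inter> set (f j) = {}"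
  shows "distinct (concat (map f [0..<d]))"
  using assms
proof (induction d)
  case (Suc d)
  then have "distinct (concat (map f [0..<d]))"
    by simp
  with Suc.prems(1)[of d] Suc.prems(2)[of _ d] show ?case
    by (auto simp: disjoint_iff)
qed simp

lemma sum_nth_distinct:
  assumes "distinct xs"
  shows "(\<Sum>i<length xs. f (xs ! i)) = sum f (set xs)"
  using sum.reindex_bij_betw[OF bij_betw_nth[OF assms refl refl]] by simp

section \<open>Monomials\<close>

definition monom_at :: "complex vec \<Rightarrow> (nat \<Rightarrow>\<^sub>0 nat) \<Rightarrow> complex" where
  "monom_at z m = (\<Prod>i<dim_vec z. (z $ i) ^ Poly_Mapping.lookup m i)"

definition top_var :: "(nat \<Rightarrow>\<^sub>0 nat) \<Rightarrow> nat" where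
  "top_var m = Max (Poly_Mapping.keys m)"

text \<open>The quotient of a nonconstant monomial by its largest variable. Exponents are written
  additively, so \<open>0\<close> stands for the monomial 1.\<close>

definition drop_top :: "(nat \<Rightarrow>\<^sub>0 nat) \<Rightarrow> (nat \<Rightarrow>\<^sub>0 nat)" where
  "drop_top m = m - Poly_Mapping.single (top_var m) 1"

lemma monom_at_zero [simp]: "monom_at z 0 = 1"
  by (simp add: monom_at_def)

lemma top_var_in_keys: "m \<noteq> 0 \<Longrightarrow> top_var m \<in> Poly_Mapping.keys m"
  unfolding top_var_def by (intro Max_in) auto

lemma lookup_drop_top:
  "Poly_Mapping.lookup (drop_top m) i =
     (if i = top_var m then Poly_Mapping.lookup m i - 1 else Poly_Mapping.lookup m i)"
  by (simp add: drop_top_def lookup_minus lookup_single when_def)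

lemma lookup_drop_top_le: "Poly_Mapping.lookup (drop_top m) i \<le> Poly_Mapping.lookup m i"
  by (simp add: lookup_drop_top)

lemma lookup_drop_top_less:
  "m \<noteq> 0 \<Longrightarrow>
    Poly_Mapping.lookup (drop_top m) (top_var m) < Poly_Mapping.lookup m (top_var m)"
  using top_var_in_keys[of m] by (simp add: lookup_drop_top in_keys_iff)

lemma keys_drop_top: "Poly_Mapping.keys (drop_top m) \<subseteq> Poly_Mapping.keys m"
  using lookup_drop_top_le[of m] by (metis in_keys_iff le_zero_eq subsetI)

lemma top_var_drop_top_le: "drop_top m \<noteq> 0 \<Longrightarrow> top_var (drop_top m) \<le> top_var m"
  using keys_drop_top[of m] unfolding top_var_def by (intro Max_mono) auto

text \<open>The exponent of the largest variable is positive, so the truncated subtraction in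
  \<open>drop_top\<close> loses exactly one factor. This is what turns \<open>Z x\<close> into the
  vector of monomials.\<close>

lemma monom_at_drop_top:
  assumes "m \<noteq> 0" "Poly_Mapping.keys m \<subseteq> {..<dim_vec z}"
  shows "z $ top_var m * monom_at z (drop_top m) = monom_at z m"
proof -
  have t: "top_var m \<in> {..<dim_vec z}" "Poly_Mapping.lookup m (top_var m) \<noteq> 0"
    using top_var_in_keys[OF assms(1)] assms(2) by (blast, simp add: in_keys_iff)
  have "z $ top_var m * (z $ top_var m) ^ (Poly_Mapping.lookup m (top_var m) - 1) =
      (z $ top_var m) ^ Poly_Mapping.lookup m (top_var m)"
    using t(2) by (metis power_minus_mult mult.commute not_gr_zero)
  moreover have "(\<Prod>i\<in>{..<dim_vec z} - {top_var m}. (z $ i) ^ Poly_Mapping.lookup (drop_top m) i) =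
      (\<Prod>i\<in>{..<dim_vec z} - {top_var m}. (z $ i) ^ Poly_Mapping.lookup m i)"
    by (intro prod.cong) (auto simp: lookup_drop_top)
  ultimately show ?thesis
    unfolding monom_at_def prod.remove[OF finite_lessThan t(1)]
    by (simp add: lookup_drop_top mult.assoc [symmetric])
qed

lemma monom_at_0v:
  assumes "m \<noteq> 0" "Poly_Mapping.keys m \<subseteq> {..<d}"
  shows "monom_at (0\<^sub>v d) m = 0"
proof -
  have "top_var m < d" "Poly_Mapping.lookup m (top_var m) \<noteq> 0"
    using top_var_in_keys[OF assms(1)] assms(2) by (blast, simp add: in_keys_iff)
  then show ?thesis
    by (auto simp: monom_at_def intro!: bexI[of _ "top_var m"])
qed

lemma finite_divisors:
  fixes k :: "'a \<Rightarrow>\<^sub>0 nat"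
  shows "finite {m :: 'a \<Rightarrow>\<^sub>0 nat. \<forall>i. Poly_Mapping.lookup m i \<le> Poly_Mapping.lookup k i}"
  (is "finite ?S")
proof -
  define K where "K = Poly_Mapping.keys k"
  \<comment> \<open>A crude bound common to all exponents: the finiteness lemma for functions needs
    one finite range for all arguments.\<close>
  define B where "B = (\<Sum>i\<in>K. Poly_Mapping.lookup k i)"
  have le: "Poly_Mapping.lookup k i \<le> B" if "i \<in> K" for i
    unfolding B_def using that by (intro member_le_sum) (auto simp: K_def)
  have "Poly_Mapping.lookup ` ?S \<subseteq> {f. \<forall>i. (i \<in> K \<longrightarrow> f i \<in> {..B}) \<and> (i \<notin> K \<longrightarrow> f i = 0)}"
  proof (clarify, intro conjI impI)
    fix m i
    assume m: "\<forall>i. Poly_Mapping.lookup m i \<le> Poly_Mapping.lookup k i"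
    show "Poly_Mapping.lookup m i \<in> {..B}" if "i \<in> K"
      using m le[OF that] by (auto intro: order_trans)
    show "Poly_Mapping.lookup m i = 0" if "i \<notin> K"
      using m[rule_format, of i] that by (simp add: K_def in_keys_iff)
  qed
  moreover have "finite {f. \<forall>i. (i \<in> K \<longrightarrow> f i \<in> {..B}) \<and> (i \<notin> K \<longrightarrow> f i = 0)}"
    by (rule finite_set_of_finite_funs) (auto simp: K_def)
  ultimately have "finite (Poly_Mapping.lookup ` ?S)"
    by (rule finite_subset)
  then show ?thesis
    by (rule finite_imageD) (auto intro: inj_onI)
qed

text \<open>Block \<open>f i\<close> collects the monomials with largest variable \<open>i\<close>,
  sorted by the exponent of \<open>i\<close>. If \<open>drop_top a\<close> is not 1, it either stays
  in the block of \<open>a\<close> with a smaller exponent or moves to an earlier block, so it never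
  comes after \<open>a\<close>.\<close>

lemma ordered_monomials:
  assumes "finite S" and "0 \<notin> S" and "\<And>m. m \<in> S \<Longrightarrow> Poly_Mapping.keys m \<subseteq> {..<d}"
  obtains f where "\<And>i. i < d \<Longrightarrow> set (f i) = {m \<in> S. top_var m = i}"
    and "set (concat (map f [0..<d])) = S"
    and "distinct (concat (map f [0..<d]))"
    and "sorted_wrt (\<lambda>a b. b \<noteq> drop_top a) (concat (map f [0..<d]))"
proof -
  obtain xs where xs: "set xs = S" "distinct xs"
    using finite_distinct_list[OF assms(1)] by blast
  define f where
    "f i = sort_key (\<lambda>m. Poly_Mapping.lookup m i) (filter (\<lambda>m. top_var m = i) xs)" for i
  have set_f: "set (f i) = {m \<in> S. top_var m = i}" for i
    by (auto simp: f_def xs)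
  have top: "top_var m < d" if "m \<in> S" for m
    using top_var_in_keys[of m] assms that by blast
  show thesis
  proof (rule that[of f])
    show "set (concat (map f [0..<d])) = S"
      using top by (auto simp: set_f)
    show "distinct (concat (map f [0..<d]))"
    proof (rule distinct_concat_map_upt)
      show "distinct (f i)" for i
        by (simp add: f_def xs)
    qed (auto simp: set_f)
    show "sorted_wrt (\<lambda>a b. b \<noteq> drop_top a) (concat (map f [0..<d]))"
    proof (rule sorted_wrt_concat_map_upt)
      fix i
      have "sorted_wrt (\<lambda>a b. Poly_Mapping.lookup a i \<le> Poly_Mapping.lookup b i) (f i)"
        unfolding f_def using sorted_map[THEN iffD1, OF sorted_sort_key] .
      then show "sorted_wrt (\<lambda>a b. b \<noteq> drop_top a) (f i)"
      proof (rule sorted_wrt_mono_rel[rotated])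
        fix a b
        assume "a \<in> set (f i)" and le: "Poly_Mapping.lookup a i \<le> Poly_Mapping.lookup b i"
        then have "a \<noteq> 0" "top_var a = i"
          using assms(2) by (auto simp: set_f)
        then show "b \<noteq> drop_top a"
          using lookup_drop_top_less[of a] le by auto
      qed
    next
      fix i j a b
      assume "i < j" "a \<in> set (f i)" "b \<in> set (f j)"
      then show "b \<noteq> drop_top a"
        using top_var_drop_top_le[of a] assms(2) by (force simp: set_f)
    qed
  qed (rule set_f)
qed

section \<open>Determinantal representation\<close>

text \<open>Monomials outside the support have coefficient 0, so the sum may run over a larger set
  that is closed under dropping variables.\<close>

lemma eval_cpoly_eq_sum:
  assumes "finite S" "Poly_Mapping.keys p \<subseteq> insert 0 S" "0 \<notin> S"
  shows "eval_cpoly p z =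
    Poly_Mapping.lookup p 0 + (\<Sum>m\<in>S. Poly_Mapping.lookup p m * monom_at z m)"
proof -
  have "eval_cpoly p z = (\<Sum>m\<in>insert 0 S. Poly_Mapping.lookup p m * monom_at z m)"
    unfolding eval_cpoly_def monom_at_def using assms
    by (intro sum.mono_neutral_left) (auto simp: in_keys_iff)
  then show ?thesis
    using assms by simp
qed

text \<open>The matrix \<open>M - b c\<close>: the first term is the entry of \<open>M\<close>. For
  nonconstant \<open>L ! i\<close>, the entry of \<open>b\<close> is 1 exactly when
  \<open>L ! i\<close> is a single variable.\<close>

definition rep_mat :: "cpoly \<Rightarrow> (nat \<Rightarrow>\<^sub>0 nat) list \<Rightarrow> complex mat" where
  "rep_mat p L = mat (length L) (length L) (\<lambda>(i, j).
     of_bool (L ! j = drop_top (L ! i)) -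
     of_bool (drop_top (L ! i) = 0) * Poly_Mapping.lookup p (L ! j))"

lemma det_rep_mat:
  fixes z :: "complex vec" and L :: "(nat \<Rightarrow>\<^sub>0 nat) list"
  assumes dist: "distinct L" and zero: "0 \<notin> set L"
    and closed: "\<And>m. m \<in> set L \<Longrightarrow> drop_top m \<in> insert 0 (set L)"
    and keys: "\<And>m. m \<in> set L \<Longrightarrow> Poly_Mapping.keys m \<subseteq> {..<dim_vec z}"
    and sorted: "sorted_wrt (\<lambda>a b. b \<noteq> drop_top a) L"
  defines "N \<equiv> length L"
  shows "det (1\<^sub>m N - rep_mat p L * mat_diag N (\<lambda>j. z $ top_var (L ! j))) =
    1 + (\<Sum>m\<in>set L. Poly_Mapping.lookup p m * monom_at z m)"
proof -
  define v where "v j = z $ top_var (L ! j)" for j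
  define A where "A = mat N N (\<lambda>(i, j). of_bool (i = j) - of_bool (L ! j = drop_top (L ! i)) * v j)"
  define x where "x = mat N 1 (\<lambda>(i, j). monom_at z (drop_top (L ! i)))"
  \<comment> \<open>This is \<open>- c Z\<close>; the sign makes \<open>I - (M - b c) Z\<close>
    equal to \<open>A - b w\<close> with \<open>A = I - M Z\<close>.\<close>
  define w where "w = mat 1 N (\<lambda>(i, j). - Poly_Mapping.lookup p (L ! j) * v j)"
  have A: "A \<in> carrier_mat N N" and x: "x \<in> carrier_mat N 1" and w: "w \<in> carrier_mat 1 N"
    by (simp_all add: A_def x_def w_def)
  have mem: "L ! i \<in> set L" if "i < N" for i
    using that by (simp add: N_def)
  have vx: "v j * monom_at z (drop_top (L ! j)) = monom_at z (L ! j)" if "j < N" for j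
    unfolding v_def using mem[OF that] zero keys by (intro monom_at_drop_top) auto
  \<comment> \<open>Row \<open>i\<close> of \<open>M Z x\<close> picks out the monomial
    \<open>drop_top (L ! i)\<close> if it is listed, which cancels the entry of \<open>x\<close>. By
    \<open>closed\<close> it is missing only when it is 1, and this leaves \<open>b\<close>.\<close>
  have Ax: "A * x = mat N 1 (\<lambda>(i, j). of_bool (drop_top (L ! i) = 0))"
  proof (rule eq_matI)
    fix i j
    assume "i < dim_row (mat N 1 (\<lambda>(i, j). of_bool (drop_top (L ! i) = 0) :: complex))"
      and "j < dim_col (mat N 1 (\<lambda>(i, j). of_bool (drop_top (L ! i) = 0) :: complex))"
    then have i: "i < N" and j: "j = 0"
      by auto
    have "(A * x) $$ (i, j) = (\<Sum>l<N. (of_bool (i = l) -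
        of_bool (L ! l = drop_top (L ! i)) * v l) * monom_at z (drop_top (L ! l)))"
      using i j by (simp add: A_def x_def scalar_prod_def lessThan_atLeast0)
    also have "\<dots> = (\<Sum>l<N. of_bool (i = l) * monom_at z (drop_top (L ! l))) -
        (\<Sum>l<N. of_bool (L ! l = drop_top (L ! i)) * monom_at z (L ! l))"
      unfolding sum_subtractf[symmetric]
      by (intro sum.cong) (auto simp: algebra_simps vx)
    also have "(\<Sum>l<N. of_bool (i = l) * monom_at z (drop_top (L ! l))) =
        monom_at z (drop_top (L ! i))"
      using i by (simp add: of_bool_def if_distrib if_distribR cong: if_cong)
    also have "(\<Sum>l<N. of_bool (L ! l = drop_top (L ! i)) * monom_at z (L ! l)) =
        (\<Sum>m\<in>set L. of_bool (m = drop_top (L ! i)) * monom_at z m)"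
      unfolding N_def using dist by (rule sum_nth_distinct)
    also have "\<dots> = of_bool (drop_top (L ! i) \<in> set L) * monom_at z (drop_top (L ! i))"
      by (simp add: of_bool_def if_distrib if_distribR cong: if_cong)
    also have "monom_at z (drop_top (L ! i)) - \<dots> = of_bool (drop_top (L ! i) = 0)"
      using closed[OF mem[OF i]] zero by auto
    finally show "(A * x) $$ (i, j) =
        mat N 1 (\<lambda>(i, j). of_bool (drop_top (L ! i) = 0)) $$ (i, j)"
      using i j by simp
  qed (simp_all add: A_def x_def)
  \<comment> \<open>The case \<open>i = j\<close> is included: \<open>M\<close> vanishes on the
    diagonal as well as above it, so \<open>A\<close> is lower triangular with unit
    diagonal.\<close>
  have no_drop: "L ! j \<noteq> drop_top (L ! i)" if "i \<le> j" "j < N" for i j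
  proof (cases "i = j")
    case True
    have "L ! j \<noteq> 0"
      using mem[OF that(2)] zero by metis
    then show ?thesis
      using lookup_drop_top_less[of "L ! j"] True by force
  next
    case False
    with that sorted show ?thesis
      by (simp add: sorted_wrt_iff_nth_less N_def)
  qed
  have "det A = prod_list (diag_mat A)"
    by (rule det_lower_triangular[OF _ A]) (simp add: A_def no_drop)
  also have "\<dots> = 1"
    unfolding prod_list_diag_prod by (rule prod.neutral) (simp add: A_def no_drop)
  finally have det_A: "det A = 1" .
  have "1\<^sub>m N - rep_mat p L * mat_diag N v = A - (A * x) * w"
    unfolding Ax
    by (subst mat_diag_mult_right[of _ N])
       (auto intro!: eq_matI simp: rep_mat_def A_def w_def N_def scalar_prod_def algebra_simps)
  then have "det (1\<^sub>m N - rep_mat p L * mat_diag N v) = 1 - (w * x) $$ (0, 0)"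
    using det_minus_rank_one[OF A x w] det_A by simp
  also have "(w * x) $$ (0, 0) = (\<Sum>j<N. - (Poly_Mapping.lookup p (L ! j) * monom_at z (L ! j)))"
    using vx by (auto simp: w_def x_def scalar_prod_def lessThan_atLeast0 mult.assoc intro!: sum.cong)
  also have "\<dots> = - (\<Sum>m\<in>set L. Poly_Mapping.lookup p m * monom_at z m)"
    unfolding N_def sum_negf using sum_nth_distinct[OF dist] by simp
  finally show ?thesis
    by (simp add: v_def [abs_def])
qed

theorem theorem2p1:
  fixes d :: nat and p :: cpoly
  assumes "d \<ge> 1"
    and "p \<in> polys_in d"
    and "eval_cpoly p (0\<^sub>v d) = 1"
  shows "\<exists>n \<in> carrier_vec d. \<exists>K \<in> carrier_mat (multi_size n) (multi_size n).
    \<forall>z \<in> carrier_vec d.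
      eval_cpoly p z = det (1\<^sub>m (multi_size n) - K * Z_mat n z)"
proof -
  \<comment> \<open>All nonconstant divisors of monomials of \<open>p\<close>; up to the monomial 1,
    this set is closed under \<open>drop_top\<close>.\<close>
  define S where "S = (\<Union>k\<in>Poly_Mapping.keys p.
    {m. \<forall>i. Poly_Mapping.lookup m i \<le> Poly_Mapping.lookup k i}) - {0}"
  have fin: "finite S"
    unfolding S_def by (intro finite_Diff finite_UN_I finite_divisors) simp
  have zero: "0 \<notin> S"
    by (simp add: S_def)
  have keys_p: "Poly_Mapping.keys p \<subseteq> insert 0 S"
    by (auto simp: S_def)
  have keys_S: "Poly_Mapping.keys m \<subseteq> {..<d}" if m: "m \<in> S" for m
  proof -
    obtain k where k: "k \<in> Poly_Mapping.keys p"
        "\<And>i. Poly_Mapping.lookup m i \<le> Poly_Mapping.lookup k i"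
      using m unfolding S_def by blast
    have "Poly_Mapping.keys m \<subseteq> Poly_Mapping.keys k"
      using k(2) by (metis in_keys_iff le_zero_eq subsetI)
    then show ?thesis
      using k(1) assms(2) by (auto simp: polys_in_def)
  qed
  have closed: "drop_top m \<in> insert 0 S" if "m \<in> S" for m
    using that unfolding S_def by (auto intro: order_trans[OF lookup_drop_top_le])
  \<comment> \<open>At the origin every nonconstant monomial vanishes, so the hypothesis on the
    value there fixes the constant coefficient.\<close>
  have const: "Poly_Mapping.lookup p 0 = 1"
    using assms(3) eval_cpoly_eq_sum[OF fin keys_p zero, of "0\<^sub>v d"] monom_at_0v[OF _ keys_S] zero
    by (metis (no_types, lifting) add.right_neutral mult_zero_right sum.neutral)
  obtain f where f: "\<And>i. i < d \<Longrightarrow> set (f i) = {m \<in> S. top_var m = i}"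
      "set (concat (map f [0..<d])) = S"
      "distinct (concat (map f [0..<d]))"
      "sorted_wrt (\<lambda>a b. b \<noteq> drop_top a) (concat (map f [0..<d]))"
    using ordered_monomials[OF fin zero keys_S] by blast
  define L where "L = concat (map f [0..<d])"
  \<comment> \<open>The multiplicity of a variable is the number of listed monomials in which it is
    the largest.\<close>
  define n where "n = vec d (\<lambda>i. length (f i))"
  have n: "n \<in> carrier_vec d"
    by (simp add: n_def)
  have size: "multi_size n = length L"
    by (simp add: multi_size_def n_def L_def length_concat comp_def
        interv_sum_list_conv_sum_set_nat lessThan_atLeast0)
  \<comment> \<open>The largest variable is constant on each block \<open>f i\<close>, so the order
    of \<open>L\<close> agrees with the repetition pattern of the diagonal.\<close>
  have Z: "Z_mat n z = mat_diag (length L) (\<lambda>j. z $ top_var (L ! j))" for z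
  proof -
    define ds where "ds = concat (map (\<lambda>i. replicate (n $ i) (z $ i)) [0..<d])"
    have "map (\<lambda>m. z $ top_var m) (f i) = replicate (n $ i) (z $ i)" if "i < d" for i
      using f(1)[OF that] that by (intro replicate_eqI) (auto simp: n_def)
    then have "ds = map (\<lambda>m. z $ top_var m) L"
      unfolding ds_def L_def map_concat map_map by (auto intro!: arg_cong[of _ _ concat])
    moreover have "Z_mat n z = mat_diag (length ds) ((!) ds)"
      unfolding Z_mat_def diag_block_mat_smult_one using n by (simp add: ds_def Let_def)
    ultimately show ?thesis
      by (auto simp: mat_diag_def intro!: eq_matI)
  qed
  have "eval_cpoly p z = det (1\<^sub>m (multi_size n) - rep_mat p L * Z_mat n z)"
    if "z \<in> carrier_vec d" for z
    unfolding size Z using f that zero closed keys_S const eval_cpoly_eq_sum[OF fin keys_p zero]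
    by (subst det_rep_mat) (auto simp: L_def)
  moreover have "rep_mat p L \<in> carrier_mat (multi_size n) (multi_size n)"
    by (simp add: rep_mat_def size)
  ultimately show ?thesis
    using n by blast
qed

end
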